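(* Let $d\ge1$, $p_0\in(0,1/2)$, let $\mathcal S\subseteq\mathcal G_d$, and let $(\lambda^{\mathrm{target}}_{J,\tau})_{(J,\tau)\in\mathcal S}$ be prescribed real values. The partial signed specification $(\lambda^{\mathrm{target}}_{J,\tau})_{(J,\tau)\in\mathcal S}$ is realizable within the witness class at scale $p_0$ if and only if there exists $w=(w_{I,\sigma})_{(I,\sigma)\in\mathcal G_d}$ satisfying $$w_{I,\sigma}\ge0\quad\text{for all }(I,\sigma)\in\mathcal G_d,$$ $$\sum_{I\supseteq J}\ \sum_{\sigma\in\{\mathrm L,\mathrm U\}^I:\,\sigma|_J=\tau}w_{I,\sigma}=\lambda^{\mathrm{target}}_{J,\tau}\quad\text{for all }(J,\tau)\in\mathcal S,$$ $$\sum_{(I,\sigma)\in\mathcal G_d:\ i\in I,\ \sigma_i=\mathrm L}w_{I,\sigma}=1,\qquad\sum_{(I,\sigma)\in\mathcal G_d:\ i\in I,\ \sigma_i=\mathrm U}w_{I,\sigma}=1,\qquad i=1,\dots,d,$$ $$\sum_{(I,\sigma)\in\mathcal G_d}w_{I,\sigma}\le\frac1{p_0}.$$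
   Context: $[d]=\{1,\dots,d\}$; $\mathcal G_d=\{(I,\sigma):\emptyset\ne I\subseteq[d],\ \sigma\in\{\mathrm L,\mathrm U\}^I\}$, where $\{\mathrm L,\mathrm U\}^I$ is the set of functions $I\to\{\mathrm L,\mathrm U\}$. Geometric witness copula at scale $p_0$. For $(I,\sigma)\in\mathcal G_d$ let $\mu_{I,\sigma}^{(p_0)}$ be the law of $(U_1,\dots,U_d)$ with $U_i=p_0Z$ if $i\in I,\sigma_i=\mathrm L$; $U_i=1-p_0Z$ if $i\in I,\sigma_i=\mathrm U$; $U_i=p_0+(1-2p_0)V_i$ if $i\notin I$, where $Z$ and the $V_i$ are independent and uniform on $[0,1]$. Let $\mu_0^{(p_0)}$ be the law of $(p_0+(1-2p_0)V_i)_{i=1}^d$ with $V_i$ i.i.d. uniform on $[0,1]$. For a nonnegative weight system $v=(v_{I,\sigma})_{(I,\sigma)\in\mathcal G_d}$ with $m_0=1-p_0\sum v_{I,\sigma}\ge0$, put $\mu^{(v,p_0)}=m_0\mu_0^{(p_0)}+\sum_{(I,\sigma)\in\mathcal G_d}p_0v_{I,\sigma}\,\mu_{I,\sigma}^{(p_0)}$. If $\mu^{(v,p_0)}$ has uniform one-dimensional margins, its distribution function $C^{(v,p_0)}$ is called a geometric witness copula at scale $p_0$. For $U\sim C$ put $\lambda^{(p_0)}_{J,\tau}(C)=\frac1{p_0}\Pr(U_i\le p_0\ \forall i\in J\text{ with }\tau_i=\mathrm L,\ U_i\ge1-p_0\ \forall i\in J\text{ with }\tau_i=\mathrm U)$.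 A partial specification is realizable within the witness class at scale $p_0$ if there is a geometric witness copula $C$ at scale $p_0$ with $\lambda^{(p_0)}_{J,\tau}(C)=\lambda^{\mathrm{target}}_{J,\tau}$ for all $(J,\tau)\in\mathcal S$. *)

theory Defs
  imports "HOL-Probability.Probability"
begin

datatype side = Lower | Upper

text \<open>Sign patterns on \<open>I\<close> are extensional functions, so that patterns \<open>(I, \<sigma>)\<close> are counted
  without repetition.\<close>

definition signed_patterns :: "nat \<Rightarrow> (nat set \<times> (nat \<Rightarrow> side)) set" where
  "signed_patterns d = {(I, \<sigma>). I \<noteq> {} \<and> I \<subseteq> {1..d} \<and> \<sigma> \<in> I \<rightarrow>\<^sub>E UNIV}"

abbreviation uniform01 :: "real measure" where
  "uniform01 \<equiv> uniform_measure lborel {0..1}"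

abbreviation vec_borel :: "nat \<Rightarrow> (nat \<Rightarrow> real) measure" where
  "vec_borel d \<equiv> (\<Pi>\<^sub>M i\<in>{1..d}. borel)"

text \<open>The sample \<open>(z, v)\<close> consists of the common variable and one coordinate \<open>v i\<close> for every
  \<open>i \<in> {1..d}\<close>; those with \<open>i \<in> I\<close> are not used.\<close>

definition pattern_law ::
  "nat \<Rightarrow> real \<Rightarrow> nat set \<times> (nat \<Rightarrow> side) \<Rightarrow> (nat \<Rightarrow> real) measure" where
  "pattern_law d p0 = (\<lambda>(I, \<sigma>).
     distr (uniform01 \<Otimes>\<^sub>M (\<Pi>\<^sub>M i\<in>{1..d}. uniform01)) (vec_borel d)
       (\<lambda>(z, v). \<lambda>i\<in>{1..d}.
          if i \<in> I then (case \<sigma> i of Lower \<Rightarrow> p0 * z | Upper \<Rightarrow> 1 - p0 * z)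
          else p0 + (1 - 2 * p0) * v i))"

definition central_law :: "nat \<Rightarrow> real \<Rightarrow> (nat \<Rightarrow> real) measure" where
  "central_law d p0 =
     distr (\<Pi>\<^sub>M i\<in>{1..d}. uniform01) (vec_borel d) (\<lambda>v. \<lambda>i\<in>{1..d}. p0 + (1 - 2 * p0) * v i)"

definition central_mass ::
  "nat \<Rightarrow> real \<Rightarrow> (nat set \<times> (nat \<Rightarrow> side) \<Rightarrow> real) \<Rightarrow> real" where
  "central_mass d p0 v = 1 - p0 * (\<Sum>g\<in>signed_patterns d. v g)"

definition witness_law ::
  "nat \<Rightarrow> real \<Rightarrow> (nat set \<times> (nat \<Rightarrow> side) \<Rightarrow> real) \<Rightarrow> (nat \<Rightarrow> real) measure" where
  "witness_law d p0 v = measure_of (space (vec_borel d)) (sets (vec_borel d))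
     (\<lambda>A. ennreal (central_mass d p0 v) * emeasure (central_law d p0) A
        + (\<Sum>g\<in>signed_patterns d. ennreal (p0 * v g) * emeasure (pattern_law d p0 g) A))"

text \<open>\<open>measure_of\<close> returns the null measure when its argument is not countably additive; the next
  lemma shows that this does not happen here.\<close>

lemma emeasure_witness_law:
  assumes A: "A \<in> sets (vec_borel d)"
  shows "emeasure (witness_law d p0 v) A =
     ennreal (central_mass d p0 v) * emeasure (central_law d p0) A
        + (\<Sum>g\<in>signed_patterns d. ennreal (p0 * v g) * emeasure (pattern_law d p0 g) A)"
proof -
  let ?f = "\<lambda>A. ennreal (central_mass d p0 v) * emeasure (central_law d p0) A
        + (\<Sum>g\<in>signed_patterns d. ennreal (p0 * v g) * emeasure (pattern_law d p0 g) A)"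
  have [simp]: "sets (central_law d p0) = sets (vec_borel d)"
    "sets (pattern_law d p0 g) = sets (vec_borel d)" for g
    by (auto simp: central_law_def pattern_law_def split: prod.splits)
  have "countably_additive (sets (vec_borel d)) ?f"
  proof (rule countably_additiveI)
    fix F :: "nat \<Rightarrow> _" assume F: "range F \<subseteq> sets (vec_borel d)" "disjoint_family F"
    show "(\<Sum>i. ?f (F i)) = ?f (\<Union>i. F i)"
      using F by (simp add: suminf_add[symmetric] suminf_sum ennreal_suminf_cmult suminf_emeasure)
  qed
  moreover have "positive (sets (vec_borel d)) ?f"
    by (simp add: positive_def)
  ultimately show ?thesis
    unfolding witness_law_def using A
    by (intro emeasure_measure_of_sigma sets.sigma_algebra_axioms)
qed

definition joint_df :: "nat \<Rightarrow> (nat \<Rightarrow> real) measure \<Rightarrow> (nat \<Rightarrow> real) \<Rightarrow> real" where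
  "joint_df d M u = measure M {x \<in> space M. \<forall>i\<in>{1..d}. x i \<le> u i}"

definition uniform_margins :: "nat \<Rightarrow> (nat \<Rightarrow> real) measure \<Rightarrow> bool" where
  "uniform_margins d M \<longleftrightarrow> (\<forall>i\<in>{1..d}. distr M borel (\<lambda>x. x i) = uniform01)"

definition geometric_witness_copula :: "nat \<Rightarrow> real \<Rightarrow> ((nat \<Rightarrow> real) \<Rightarrow> real) \<Rightarrow> bool" where
  "geometric_witness_copula d p0 C \<longleftrightarrow>
     (\<exists>v. (\<forall>g\<in>signed_patterns d. v g \<ge> 0) \<and> central_mass d p0 v \<ge> 0 \<and>
        uniform_margins d (witness_law d p0 v) \<and> C = joint_df d (witness_law d p0 v))"

definition has_law ::
  "nat \<Rightarrow> ((nat \<Rightarrow> real) \<Rightarrow> real) \<Rightarrow> (nat \<Rightarrow> real) measure \<Rightarrow> bool" where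
  "has_law d C M \<longleftrightarrow> prob_space M \<and> sets M = sets (vec_borel d) \<and> joint_df d M = C"

lemma has_law_unique:
  assumes M: "has_law d C M" and N: "has_law d C N"
  shows "M = N"
proof -
  let ?I = "{1..d}"
  define box where "box u = {x \<in> ?I \<rightarrow>\<^sub>E UNIV. \<forall>i\<in>?I. x i \<le> u i}" for u :: "nat \<Rightarrow> real"
  let ?E = "range box"
  interpret M: prob_space M using M by (simp add: has_law_def)
  interpret N: prob_space N using N by (simp add: has_law_def)
  have sp: "space M = ?I \<rightarrow>\<^sub>E UNIV" "space N = ?I \<rightarrow>\<^sub>E UNIV"
    and st: "sets M = sets (vec_borel d)" "sets N = sets (vec_borel d)"
    using M N sets_eq_imp_space_eq[of M "vec_borel d"] sets_eq_imp_space_eq[of N "vec_borel d"]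
    by (auto simp: has_law_def space_PiM)
  have fE: "\<exists>u. F = box u"
    if "F = {f \<in> ?I \<rightarrow>\<^sub>E UNIV. \<forall>i\<in>?I. f i \<in> A i}" "A \<in> ?I \<rightarrow> range (\<lambda>a::real. {..a})" for F A
  proof -
    have "\<exists>u. \<forall>i\<in>?I. A i = {..u i}"
      using that(2) by (intro bchoice) auto
    then obtain u where "\<forall>i\<in>?I. A i = {..u i}" ..
    then show ?thesis
      using that(1) by (intro exI[of _ u]) (simp add: box_def cong: conj_cong)
  qed
  have P: "{{f \<in> ?I \<rightarrow>\<^sub>E UNIV. \<forall>i\<in>j. f i \<in> A i} |A j. j \<in> {?I} \<and> A \<in> j \<rightarrow> range (\<lambda>a::real. {..a})} = ?E"
    (is "?P = _")
  proof (intro equalityI subsetI)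
    fix F assume "F \<in> ?P"
    then obtain A where "F = {f \<in> ?I \<rightarrow>\<^sub>E UNIV. \<forall>i\<in>?I. f i \<in> A i}"
      and "A \<in> ?I \<rightarrow> range (\<lambda>a::real. {..a})"
      unfolding mem_Collect_eq by (elim exE conjE) (simp only: singleton_iff)
    from fE[OF this] obtain u where "F = box u" ..
    then show "F \<in> ?E" by blast
  next
    fix F assume "F \<in> ?E"
    then obtain u where "F = box u" by blast
    then have F: "F = {f \<in> ?I \<rightarrow>\<^sub>E UNIV. \<forall>i\<in>?I. f i \<in> {..u i}}"
      by (simp add: box_def)
    show "F \<in> ?P"
      unfolding mem_Collect_eq
      by (rule exI[of _ "\<lambda>i. {..u i}"], rule exI[of _ ?I]) (use F in \<open>simp add: Pi_def\<close>)
  qed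
  have gen: "sets (vec_borel d) = sigma_sets (?I \<rightarrow>\<^sub>E UNIV) ?E"
  proof -
    have "sets (\<Pi>\<^sub>M i\<in>?I. sigma UNIV (range (\<lambda>a::real. {..a}))) = sets (sigma (?I \<rightarrow>\<^sub>E UNIV)
        {{f \<in> ?I \<rightarrow>\<^sub>E UNIV. \<forall>i\<in>j. f i \<in> A i} |A j. j \<in> {?I} \<and> A \<in> j \<rightarrow> range (\<lambda>a. {..a})})"
    proof (rule sets_PiM_sigma)
      show "\<exists>S\<subseteq>range (\<lambda>a::real. {..a}). countable S \<and> UNIV = \<Union> S" for i :: nat
        using real_arch_simple
        by (intro exI[of _ "range (\<lambda>k::nat. {..real k})"]) fastforce
    qed auto
    also have "\<dots> = sigma_sets (?I \<rightarrow>\<^sub>E UNIV) ?E"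
      unfolding P by (intro sets_measure_of) (auto simp: box_def)
    finally show ?thesis
      by (simp add: borel_eq_atMost)
  qed
  have df: "emeasure M (box u) = emeasure N (box u)" for u
  proof -
    have "joint_df d M u = joint_df d N u"
      using M N by (simp add: has_law_def)
    then show ?thesis
      by (simp add: joint_df_def box_def sp M.emeasure_eq_measure N.emeasure_eq_measure)
  qed
  show ?thesis
  proof (rule measure_eqI_generator_eq)
    show "Int_stable ?E"
    proof (rule Int_stableI)
      fix F G assume "F \<in> ?E" "G \<in> ?E"
      then obtain u v where "F = box u" "G = box v" by blast
      then have "F \<inter> G = box (\<lambda>i. min (u i) (v i))"
        by (auto simp: box_def)
      then show "F \<inter> G \<in> ?E"
        by blast
    qed
    show "?E \<subseteq> Pow (?I \<rightarrow>\<^sub>E UNIV)"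
      by (auto simp: box_def)
    show "emeasure M X = emeasure N X" if "X \<in> ?E" for X
      using that df by blast
    show "sets M = sigma_sets (?I \<rightarrow>\<^sub>E UNIV) ?E" "sets N = sigma_sets (?I \<rightarrow>\<^sub>E UNIV) ?E"
      using st gen by auto
    show "range (\<lambda>k::nat. box (\<lambda>_. real k)) \<subseteq> ?E"
      by blast
    show "(\<Union>k::nat. box (\<lambda>_. real k)) = ?I \<rightarrow>\<^sub>E UNIV"
    proof (intro equalityI subsetI)
      fix x assume x: "x \<in> ?I \<rightarrow>\<^sub>E (UNIV :: real set)"
      obtain k :: nat where k: "(\<Sum>i\<in>?I. \<bar>x i\<bar>) \<le> real k"
        using real_arch_simple by blast
      have "x i \<le> real k" if "i \<in> ?I" for i
        using member_le_sum[of i ?I "\<lambda>i. \<bar>x i\<bar>"] that k by simp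
      then show "x \<in> (\<Union>k::nat. box (\<lambda>_. real k))"
        using x by (auto simp only: box_def)
    qed (auto simp: box_def)
    show "emeasure M (box (\<lambda>_. real k)) \<noteq> \<infinity>" for k :: nat
      by simp
  qed
qed

text \<open>The law with distribution function \<open>C\<close>; by the lemma above there is at most one.\<close>

definition copula_law :: "nat \<Rightarrow> ((nat \<Rightarrow> real) \<Rightarrow> real) \<Rightarrow> (nat \<Rightarrow> real) measure" where
  "copula_law d C = (THE M. has_law d C M)"

definition signed_tail_coeff ::
  "nat \<Rightarrow> real \<Rightarrow> ((nat \<Rightarrow> real) \<Rightarrow> real) \<Rightarrow> nat set \<times> (nat \<Rightarrow> side) \<Rightarrow> real" where
  "signed_tail_coeff d p0 C = (\<lambda>(J, \<tau>).
     1 / p0 * measure (copula_law d C)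
       {x \<in> space (copula_law d C). \<forall>i\<in>J. case \<tau> i of Lower \<Rightarrow> x i \<le> p0 | Upper \<Rightarrow> x i \<ge> 1 - p0})"

definition witness_realizable ::
  "nat \<Rightarrow> real \<Rightarrow> (nat set \<times> (nat \<Rightarrow> side)) set \<Rightarrow> (nat set \<times> (nat \<Rightarrow> side) \<Rightarrow> real) \<Rightarrow> bool" where
  "witness_realizable d p0 S target \<longleftrightarrow>
     (\<exists>C. geometric_witness_copula d p0 C \<and>
        (\<forall>g\<in>S. signed_tail_coeff d p0 C g = target g))"

end

theory Submission
  imports Defs
begin

text \<open>A witness law is a mixture whose components only take three kinds of values in a coordinate:
  in the lower tail \<open>[0, p0]\<close>, in the upper tail \<open>[1 - p0, 1]\<close>, or in the centre
  \<open>[p0, 1 - p0]\<close>. As \<open>p0 < 1 / 2\<close>, these intervals meet in null sets only, so up to a null set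
  the component of a pattern \<open>(I, \<sigma>)\<close> visits the tail \<open>s\<close> in coordinate \<open>i\<close> exactly when
  \<open>i \<in> I\<close> and \<open>\<sigma> i = s\<close> (\<open>AE_in_tail_coordinate_map\<close>). A joint tail event thus has probability
  \<open>1\<close> or \<open>0\<close> under each component, and its probability under the mixture is \<open>p0\<close> times the total
  weight of the patterns that extend it (\<open>emeasure_witness_law_tail_event\<close>). After division by
  \<open>p0\<close> this says that the tail coefficients are exactly the superset sums of the weights.

  The remaining constraints describe which weights are admissible. The bound on the total weight is
  nonnegativity of the central mass. If the margins are uniform, then the one-coordinate tail
  events have probability \<open>p0\<close>, so the weights that meet a fixed tail of a fixed coordinate add up
  to \<open>1\<close>. Conversely, if they do, then the margin in coordinate \<open>i\<close> puts mass \<open>p0\<close>, \<open>p0\<close> and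
  \<open>1 - 2 * p0\<close> on the three intervals, uniformly on each; these masses are the lengths of the
  intervals, so the margin is uniform on \<open>[0, 1]\<close> (\<open>uniform_margins_witness_law_iff\<close>). Hence the
  weights of a witness copula are themselves the required solution, and conversely.\<close>

section \<open>The coordinates of the components\<close>

definition coordinate_map ::
  "real \<Rightarrow> nat set \<Rightarrow> (nat \<Rightarrow> side) \<Rightarrow> nat \<Rightarrow> real \<Rightarrow> real" where
  "coordinate_map p0 I \<sigma> i z =
     (if i \<in> I then (case \<sigma> i of Lower \<Rightarrow> p0 * z | Upper \<Rightarrow> 1 - p0 * z)
      else p0 + (1 - 2 * p0) * z)"

definition in_tail :: "real \<Rightarrow> side \<Rightarrow> real \<Rightarrow> bool" where
  "in_tail p0 s x = (case s of Lower \<Rightarrow> x \<le> p0 | Upper \<Rightarrow> x \<ge> 1 - p0)"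

definition tail_event :: "nat \<Rightarrow> real \<Rightarrow> nat set \<Rightarrow> (nat \<Rightarrow> side) \<Rightarrow> (nat \<Rightarrow> real) set" where
  "tail_event d p0 J \<tau> = {x \<in> space (vec_borel d). \<forall>i\<in>J. in_tail p0 (\<tau> i) (x i)}"

lemma coordinate_map_measurable [measurable]: "coordinate_map p0 I \<sigma> i \<in> borel_measurable borel"
  unfolding coordinate_map_def by (cases "\<sigma> i"; cases "i \<in> I") simp_all

lemma pred_in_tail [measurable]: "Measurable.pred borel (in_tail p0 s)"
  unfolding in_tail_def by (cases s) simp_all

lemma sets_tail_event:
  assumes "J \<subseteq> {1..d}"
  shows "tail_event d p0 J \<tau> \<in> sets (vec_borel d)"
proof -
  have "finite J" using assms finite_subset by blast
  moreover have [measurable]: "(\<lambda>x. x i) \<in> borel_measurable (vec_borel d)" if "i \<in> J" for i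
    using assms that by (intro measurable_component_singleton) auto
  ultimately show ?thesis
    unfolding tail_event_def by measurable
qed

lemma prob_space_uniform01: "prob_space uniform01"
  by (intro prob_space_uniform_measure) auto

lemma prob_space_PiM_uniform01: "prob_space (\<Pi>\<^sub>M i\<in>{1..d::nat}. uniform01)"
  by (intro prob_space_PiM prob_space_uniform01)

text \<open>Only the endpoints \<open>z = 0\<close> and \<open>z = 1\<close> can be exceptional: a central coordinate then sits on
  the boundary of a tail. That a coordinate in one tail never reaches the other needs
  \<open>p0 < 1 / 2\<close>.\<close>

lemma AE_in_tail_coordinate_map:
  assumes "0 < p0" "p0 < 1 / 2"
  shows "AE z in uniform01.
    \<forall>s. in_tail p0 s (coordinate_map p0 I \<sigma> i z) \<longleftrightarrow> i \<in> I \<and> \<sigma> i = s"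
proof (rule AE_uniform_measureI)
  have *: "\<forall>s. in_tail p0 s (coordinate_map p0 I \<sigma> i z) \<longleftrightarrow> i \<in> I \<and> \<sigma> i = s"
    if z: "0 < z" "z < 1" for z
  proof -
    define a b where ab: "a = p0 * z" "b = (1 - 2 * p0) * z"
    have "a < p0" "0 < b" "b < 1 - 2 * p0"
      using z assms by (auto simp: ab)
    then show ?thesis
      using assms by (auto simp: in_tail_def coordinate_map_def simp flip: ab split: side.split)
  qed
  show "AE z in lborel. z \<in> {0..1} \<longrightarrow>
      (\<forall>s. in_tail p0 s (coordinate_map p0 I \<sigma> i z) \<longleftrightarrow> i \<in> I \<and> \<sigma> i = s)"
    using AE_lborel_singleton[of 0] AE_lborel_singleton[of "1::real"]
  proof eventually_elim
    case (elim z)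
    show ?case using elim by (intro impI *) auto
  qed
qed simp

lemma emeasure_uniform01:
  assumes "A \<in> sets borel"
  shows "emeasure uniform01 A = emeasure lborel (A \<inter> {0..1})"
  using assms by (simp add: divide_ennreal_def Int_commute)

text \<open>An affine map with slope \<open>c\<close> sends the uniform law to the uniform law on the image interval.
  Clearing the denominator \<open>\<bar>c\<bar>\<close> is what makes the three pieces of a margin add up directly.\<close>

lemma emeasure_affine_image_uniform01:
  fixes c t :: real
  assumes "c \<noteq> 0" and [measurable]: "A \<in> sets borel"
  shows "ennreal \<bar>c\<bar> * emeasure (distr uniform01 borel (\<lambda>z. t + c * z)) A =
    emeasure lborel (A \<inter> (\<lambda>z. t + c * z) ` {0..1})"
proof -
  let ?f = "\<lambda>z. t + c * z"
  have "compact (?f ` {0..1})"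
    by (intro compact_continuous_image continuous_intros) auto
  then have [measurable]: "?f ` {0..1} \<in> sets borel"
    by (simp add: borel_compact)
  have inj: "inj ?f"
    using assms by (auto simp: inj_def)
  have vim: "?f -` A \<inter> {0..1} = ?f -` (A \<inter> ?f ` {0..1})"
    using inj by (auto simp: inj_def)
  have "?f -` A \<in> sets borel"
    by (rule measurable_sets_borel[of _ borel]) auto
  then have "emeasure (distr uniform01 borel ?f) A = emeasure lborel (?f -` (A \<inter> ?f ` {0..1}))"
    unfolding vim[symmetric]
    by (simp add: emeasure_distr emeasure_uniform01 del: emeasure_uniform_measure)
  also have "ennreal \<bar>c\<bar> * \<dots> =
      emeasure (density (distr lborel borel ?f) (\<lambda>_. ennreal \<bar>c\<bar>)) (A \<inter> ?f ` {0..1})"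
    by (simp add: emeasure_density_const emeasure_distr)
  also have "\<dots> = emeasure lborel (A \<inter> ?f ` {0..1})"
    using lborel_real_affine[OF assms(1), of t] by simp
  finally show ?thesis .
qed

section \<open>The components of the mixture\<close>

lemma sets_pattern_law [simp, measurable_cong]: "sets (pattern_law d p0 g) = sets (vec_borel d)"
  by (simp add: pattern_law_def split: prod.split)

lemma sets_central_law [simp, measurable_cong]: "sets (central_law d p0) = sets (vec_borel d)"
  by (simp add: central_law_def)

lemma pattern_law_coordinate_map:
  "pattern_law d p0 (I, \<sigma>) = distr (uniform01 \<Otimes>\<^sub>M (\<Pi>\<^sub>M i\<in>{1..d}. uniform01)) (vec_borel d)
     (\<lambda>\<omega>. \<lambda>i\<in>{1..d}. coordinate_map p0 I \<sigma> i (if i \<in> I then fst \<omega> else snd \<omega> i))"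
  unfolding pattern_law_def coordinate_map_def
  by (auto simp: fun_eq_iff split: side.split intro!: distr_cong)

lemma central_law_coordinate_map:
  "central_law d p0 = distr (\<Pi>\<^sub>M i\<in>{1..d}. uniform01) (vec_borel d)
     (\<lambda>v. \<lambda>i\<in>{1..d}. coordinate_map p0 {} \<sigma> i (v i))"
  unfolding central_law_def coordinate_map_def by simp

lemma measurable_uniform01_coordinate:
  assumes "i \<in> {1..d::nat}"
  shows "(\<lambda>v. v i) \<in> borel_measurable (\<Pi>\<^sub>M i\<in>{1..d}. uniform01)"
  using measurable_component_singleton[OF assms, of "\<lambda>_. uniform01"]
  by (simp cong: measurable_cong_sets)

lemma measurable_pattern_sample_coordinate:
  assumes "i \<in> {1..d::nat}"
  shows "(\<lambda>\<omega>. if i \<in> I then fst \<omega> else snd \<omega> i)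
    \<in> borel_measurable (uniform01 \<Otimes>\<^sub>M (\<Pi>\<^sub>M i\<in>{1..d}. uniform01))"
proof -
  have "(\<lambda>\<omega>. snd \<omega> i) \<in> borel_measurable (uniform01 \<Otimes>\<^sub>M (\<Pi>\<^sub>M i\<in>{1..d}. uniform01))"
    by (rule measurable_compose[OF measurable_snd measurable_uniform01_coordinate[OF assms]])
  moreover have "fst \<in> borel_measurable (uniform01 \<Otimes>\<^sub>M (\<Pi>\<^sub>M i\<in>{1..d}. uniform01))"
    using measurable_fst[of uniform01 "\<Pi>\<^sub>M i\<in>{1..d}. uniform01"]
    by (simp cong: measurable_cong_sets)
  ultimately show ?thesis
    by (cases "i \<in> I") simp_all
qed

lemma distr_uniform01_coordinate:
  assumes "i \<in> {1..d::nat}"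
  shows "distr (\<Pi>\<^sub>M i\<in>{1..d}. uniform01) borel (\<lambda>v. v i) = uniform01"
proof -
  have "distr (\<Pi>\<^sub>M i\<in>{1..d}. uniform01) borel (\<lambda>v. v i) =
      distr (\<Pi>\<^sub>M i\<in>{1..d}. uniform01) uniform01 (\<lambda>v. v i)"
    by (intro distr_cong) simp_all
  also have "\<dots> = uniform01"
    by (rule distr_PiM_component[OF prob_space_uniform01 assms])
  finally show ?thesis .
qed

lemma distr_pattern_sample_coordinate:
  assumes i: "i \<in> {1..d::nat}"
  shows "distr (uniform01 \<Otimes>\<^sub>M (\<Pi>\<^sub>M i\<in>{1..d}. uniform01)) borel
    (\<lambda>\<omega>. if i \<in> I then fst \<omega> else snd \<omega> i) = uniform01"
proof -
  let ?P = "\<Pi>\<^sub>M i\<in>{1..d}. uniform01"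
  interpret U: prob_space uniform01 by (rule prob_space_uniform01)
  interpret P: prob_space ?P by (rule prob_space_PiM_uniform01)
  interpret UP: pair_prob_space uniform01 ?P ..
  have fst: "distr (uniform01 \<Otimes>\<^sub>M ?P) borel fst = uniform01"
    using P.distr_pair_fst[of uniform01]
    by (subst distr_cong[OF refl, of _ uniform01 _ fst]) simp_all
  have "distr (uniform01 \<Otimes>\<^sub>M ?P) ?P snd = ?P"
  proof (rule measure_eqI)
    fix A assume "A \<in> sets (distr (uniform01 \<Otimes>\<^sub>M ?P) ?P snd)"
    then have A: "A \<in> sets ?P" by simp
    have "snd -` A \<inter> space (uniform01 \<Otimes>\<^sub>M ?P) = space uniform01 \<times> A"
      using sets.sets_into_space[OF A] by (auto simp: space_pair_measure)
    then show "emeasure (distr (uniform01 \<Otimes>\<^sub>M ?P) ?P snd) A = emeasure ?P A"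
      using P.emeasure_pair_measure_Times[OF sets.top A, of uniform01] U.emeasure_space_1
      by (simp only: emeasure_distr[OF measurable_snd A] mult_1)
  qed simp
  then have "distr (uniform01 \<Otimes>\<^sub>M ?P) borel (\<lambda>\<omega>. snd \<omega> i) = distr ?P borel (\<lambda>v. v i)"
    using distr_distr[OF measurable_uniform01_coordinate[OF i] measurable_snd, of uniform01]
    by (simp add: comp_def)
  then have "distr (uniform01 \<Otimes>\<^sub>M ?P) borel (\<lambda>\<omega>. snd \<omega> i) = uniform01"
    by (simp only: distr_uniform01_coordinate[OF i])
  with fst show ?thesis
    by (cases "i \<in> I") simp_all
qed

lemma measurable_pattern_map:
  "(\<lambda>\<omega>. \<lambda>i\<in>{1..d}. coordinate_map p0 I \<sigma> i (if i \<in> I then fst \<omega> else snd \<omega> i))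
     \<in> measurable (uniform01 \<Otimes>\<^sub>M (\<Pi>\<^sub>M i\<in>{1..d}. uniform01)) (vec_borel d)"
  by (intro measurable_restrict measurable_compose[OF measurable_pattern_sample_coordinate]) simp_all

lemma measurable_central_map:
  "(\<lambda>v. \<lambda>i\<in>{1..d}. coordinate_map p0 I \<sigma> i (v i))
     \<in> measurable (\<Pi>\<^sub>M i\<in>{1..d}. uniform01) (vec_borel d)"
  by (intro measurable_restrict measurable_compose[OF measurable_uniform01_coordinate]) simp_all

lemma prob_space_pattern_law: "prob_space (pattern_law d p0 g)"
proof -
  obtain I \<sigma> where g: "g = (I, \<sigma>)" by (cases g)
  have "prob_space (uniform01 \<Otimes>\<^sub>M (\<Pi>\<^sub>M i\<in>{1..d}. uniform01))"
    by (intro prob_space_pair prob_space_uniform01 prob_space_PiM_uniform01)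
  from prob_space.prob_space_distr[OF this measurable_pattern_map] show ?thesis
    unfolding g pattern_law_coordinate_map .
qed

lemma prob_space_central_law: "prob_space (central_law d p0)"
  unfolding central_law_coordinate_map[where \<sigma> = undefined]
  by (rule prob_space.prob_space_distr[OF prob_space_PiM_uniform01 measurable_central_map])

lemma margin_pattern_law:
  assumes i: "i \<in> {1..d}"
  shows "distr (pattern_law d p0 (I, \<sigma>)) borel (\<lambda>x. x i) =
    distr uniform01 borel (coordinate_map p0 I \<sigma> i)"
proof -
  let ?UP = "uniform01 \<Otimes>\<^sub>M (\<Pi>\<^sub>M i\<in>{1..d}. uniform01)"
  let ?z = "\<lambda>\<omega>. if i \<in> I then fst \<omega> else snd \<omega> i"
  have "distr (pattern_law d p0 (I, \<sigma>)) borel (\<lambda>x. x i) =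
      distr ?UP borel (coordinate_map p0 I \<sigma> i \<circ> ?z)"
    unfolding pattern_law_coordinate_map
    using i by (subst distr_distr[OF measurable_component_singleton[OF i] measurable_pattern_map])
      (simp add: comp_def)
  also have "\<dots> = distr (distr ?UP borel ?z) borel (coordinate_map p0 I \<sigma> i)"
    by (rule distr_distr[symmetric, OF _ measurable_pattern_sample_coordinate[OF i]]) simp
  finally show ?thesis
    by (simp only: distr_pattern_sample_coordinate[OF i])
qed

lemma margin_central_law:
  assumes i: "i \<in> {1..d}"
  shows "distr (central_law d p0) borel (\<lambda>x. x i) =
    distr uniform01 borel (coordinate_map p0 {} \<sigma> i)"
proof -
  let ?P = "\<Pi>\<^sub>M i\<in>{1..d}. uniform01"
  have "distr (central_law d p0) borel (\<lambda>x. x i) =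
      distr ?P borel (coordinate_map p0 {} \<sigma> i \<circ> (\<lambda>v. v i))"
    unfolding central_law_coordinate_map[where \<sigma> = \<sigma>]
    using i by (subst distr_distr[OF measurable_component_singleton[OF i] measurable_central_map])
      (simp add: comp_def)
  also have "\<dots> = distr (distr ?P borel (\<lambda>v. v i)) borel (coordinate_map p0 {} \<sigma> i)"
    by (rule distr_distr[symmetric, OF _ measurable_uniform01_coordinate[OF i]]) simp
  finally show ?thesis
    by (simp only: distr_uniform01_coordinate[OF i])
qed

text \<open>Each margin lies in a given tail either almost surely or almost never. Finitely many such
  statements hold simultaneously almost surely, so the margins alone determine the joint tail
  probability, and it is \<open>0\<close> or \<open>1\<close>. The case \<open>I = {}\<close> serves the central law.\<close>

lemma emeasure_tail_event_from_margins:
  assumes p0: "0 < p0" "p0 < 1 / 2" and J: "J \<subseteq> {1..d}"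
    and M: "prob_space M" "sets M = sets (vec_borel d)"
    and margin: "\<And>i. i \<in> {1..d} \<Longrightarrow>
      distr M borel (\<lambda>x. x i) = distr uniform01 borel (coordinate_map p0 I \<sigma> i)"
  shows "emeasure M (tail_event d p0 J \<tau>) = (if J \<subseteq> I \<and> (\<forall>i\<in>J. \<sigma> i = \<tau> i) then 1 else 0)"
proof -
  interpret prob_space M by (rule M)
  have sp: "space M = space (vec_borel d)"
    by (rule sets_eq_imp_space_eq[OF M(2)])
  have ev: "tail_event d p0 J \<tau> \<in> events"
    using sets_tail_event[OF J] by (simp add: M(2))
  have "AE x in M. in_tail p0 (\<tau> i) (x i) \<longleftrightarrow> i \<in> I \<and> \<sigma> i = \<tau> i" if i: "i \<in> J" for i
  proof -
    have *: "{y \<in> space borel. in_tail p0 (\<tau> i) y \<longleftrightarrow> i \<in> I \<and> \<sigma> i = \<tau> i} \<in> sets borel"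
      by measurable
    have comp: "(\<lambda>x. x i) \<in> borel_measurable M"
      using measurable_component_singleton[of i "{1..d}" "\<lambda>_. borel"] i J
      by (auto simp: M(2) cong: measurable_cong_sets)
    have "AE z in uniform01. in_tail p0 (\<tau> i) (coordinate_map p0 I \<sigma> i z) \<longleftrightarrow> i \<in> I \<and> \<sigma> i = \<tau> i"
      using AE_in_tail_coordinate_map[OF p0, of I \<sigma> i] by eventually_elim blast
    then have "AE y in distr uniform01 borel (coordinate_map p0 I \<sigma> i).
        in_tail p0 (\<tau> i) y \<longleftrightarrow> i \<in> I \<and> \<sigma> i = \<tau> i"
      by (subst AE_distr_iff[OF _ *]) simp_all
    then have "AE y in distr M borel (\<lambda>x. x i). in_tail p0 (\<tau> i) y \<longleftrightarrow> i \<in> I \<and> \<sigma> i = \<tau> i"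
      by (subst margin) (use i J in auto)
    then show ?thesis
      by (subst (asm) AE_distr_iff[OF comp *])
  qed
  then have "AE x in M. \<forall>i\<in>J. in_tail p0 (\<tau> i) (x i) \<longleftrightarrow> i \<in> I \<and> \<sigma> i = \<tau> i"
    using J by (intro AE_finite_allI) (auto intro: finite_subset)
  then have ae: "AE x in M.
      x \<in> tail_event d p0 J \<tau> \<longleftrightarrow> J \<subseteq> I \<and> (\<forall>i\<in>J. \<sigma> i = \<tau> i)"
    using AE_space by eventually_elim (auto simp: tail_event_def sp)
  show ?thesis
  proof (cases "J \<subseteq> I \<and> (\<forall>i\<in>J. \<sigma> i = \<tau> i)")
    case True
    with ae ev have "prob (tail_event d p0 J \<tau>) = 1"
      by (subst prob_eq_1) auto
    with True show ?thesis
      by (simp add: emeasure_eq_measure)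
  next
    case False
    with ae ev have "prob (tail_event d p0 J \<tau>) = 0"
      by (subst prob_eq_0) auto
    with False show ?thesis
      by (simp add: emeasure_eq_measure)
  qed
qed

section \<open>The mixture\<close>

definition pattern_extensions ::
  "nat \<Rightarrow> nat set \<Rightarrow> (nat \<Rightarrow> side) \<Rightarrow> (nat set \<times> (nat \<Rightarrow> side)) set" where
  "pattern_extensions d J \<tau> = {(I, \<sigma>) \<in> signed_patterns d. J \<subseteq> I \<and> (\<forall>i\<in>J. \<sigma> i = \<tau> i)}"

lemma finite_UNIV_side: "finite (UNIV :: side set)"
proof -
  have "(UNIV :: side set) = {Lower, Upper}"
    using side.exhaust by auto
  then show ?thesis
    by (metis finite.emptyI finite.insertI)
qed

lemma finite_signed_patterns [simp]: "finite (signed_patterns d)"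
proof -
  have "signed_patterns d \<subseteq> (SIGMA I : Pow {1..d}. I \<rightarrow>\<^sub>E UNIV)"
    by (auto simp: signed_patterns_def)
  moreover have "finite (SIGMA I : Pow {1..d}. I \<rightarrow>\<^sub>E (UNIV :: side set))"
    by (intro finite_SigmaI finite_PiE finite_UNIV_side) (auto intro: finite_subset)
  ultimately show ?thesis
    by (rule finite_subset)
qed

lemma sets_witness_law [simp, measurable_cong]: "sets (witness_law d p0 v) = sets (vec_borel d)"
  unfolding witness_law_def
  by (subst sets_measure_of) (auto simp: sets.space_closed sets.sigma_sets_eq)

lemma space_witness_law [simp]: "space (witness_law d p0 v) = space (vec_borel d)"
  by (rule sets_eq_imp_space_eq) simp

lemma prob_space_witness_law:
  assumes "0 < p0" "\<forall>g\<in>signed_patterns d. v g \<ge> 0" "central_mass d p0 v \<ge> 0"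
  shows "prob_space (witness_law d p0 v)"
proof
  have 1: "emeasure (central_law d p0) (space (vec_borel d)) = 1"
    "emeasure (pattern_law d p0 g) (space (vec_borel d)) = 1" for g
    using prob_space.emeasure_space_1[OF prob_space_central_law, of d p0]
      prob_space.emeasure_space_1[OF prob_space_pattern_law, of d p0 g]
      sets_eq_imp_space_eq[OF sets_central_law, of d p0]
      sets_eq_imp_space_eq[OF sets_pattern_law, of d p0 g]
    by simp_all
  have "emeasure (witness_law d p0 v) (space (witness_law d p0 v)) =
      ennreal (central_mass d p0 v) + (\<Sum>g\<in>signed_patterns d. ennreal (p0 * v g))"
    by (simp add: emeasure_witness_law 1 del: One_nat_def)
  also have "\<dots> = ennreal (central_mass d p0 v + (\<Sum>g\<in>signed_patterns d. p0 * v g))"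
    using assms by (simp add: sum_nonneg)
  also have "\<dots> = 1"
    by (simp add: central_mass_def sum_distrib_left)
  finally show "emeasure (witness_law d p0 v) (space (witness_law d p0 v)) = 1" .
qed

lemma emeasure_witness_law_tail_event:
  assumes p0: "0 < p0" "p0 < 1 / 2" and J: "J \<noteq> {}" "J \<subseteq> {1..d}"
    and v: "\<forall>g\<in>signed_patterns d. v g \<ge> 0"
  shows "emeasure (witness_law d p0 v) (tail_event d p0 J \<tau>) =
    ennreal (p0 * (\<Sum>g\<in>pattern_extensions d J \<tau>. v g))"
proof -
  have central: "emeasure (central_law d p0) (tail_event d p0 J \<tau>) = 0"
    using J emeasure_tail_event_from_margins[OF p0 J(2) prob_space_central_law sets_central_law
        margin_central_law, of \<tau> \<tau>] by simp
  have pattern: "emeasure (pattern_law d p0 g) (tail_event d p0 J \<tau>) =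
      (if g \<in> pattern_extensions d J \<tau> then 1 else 0)" if "g \<in> signed_patterns d" for g
  proof -
    obtain I \<sigma> where g: "g = (I, \<sigma>)" by (cases g)
    show ?thesis
      using that unfolding g
      by (subst emeasure_tail_event_from_margins[OF p0 J(2) prob_space_pattern_law
            sets_pattern_law margin_pattern_law])
        (auto simp: pattern_extensions_def)
  qed
  have "emeasure (witness_law d p0 v) (tail_event d p0 J \<tau>) =
      (\<Sum>g\<in>signed_patterns d. ennreal (p0 * v g) * (if g \<in> pattern_extensions d J \<tau> then 1 else 0))"
    using sets_tail_event[OF J(2)]
    by (simp add: emeasure_witness_law central pattern cong: sum.cong)
  also have "\<dots> = (\<Sum>g\<in>pattern_extensions d J \<tau>. ennreal (p0 * v g))"
    by (intro sum.mono_neutral_cong_right) (auto simp: pattern_extensions_def)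
  also have "\<dots> = ennreal (\<Sum>g\<in>pattern_extensions d J \<tau>. p0 * v g)"
    using p0 v by (intro sum_ennreal) (auto simp: pattern_extensions_def)
  finally show ?thesis
    by (simp add: sum_distrib_left)
qed

text \<open>The tail coefficients of a copula refer to the law recovered from its distribution function;
  uniqueness of that law brings them back to the mixture.\<close>

lemma copula_law_joint_df:
  assumes "prob_space M" "sets M = sets (vec_borel d)"
  shows "copula_law d (joint_df d M) = M"
  unfolding copula_law_def
proof (rule the_equality)
  show "has_law d (joint_df d M) M"
    using assms by (simp add: has_law_def)
  then show "N = M" if "has_law d (joint_df d M) N" for N
    using that has_law_unique by blast
qed

lemma signed_tail_coeff_witness:
  assumes p0: "0 < p0" "p0 < 1 / 2" and J: "J \<noteq> {}" "J \<subseteq> {1..d}"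
    and v: "\<forall>g\<in>signed_patterns d. v g \<ge> 0" "central_mass d p0 v \<ge> 0"
  shows "signed_tail_coeff d p0 (joint_df d (witness_law d p0 v)) (J, \<tau>) =
    (\<Sum>g\<in>pattern_extensions d J \<tau>. v g)"
proof -
  have "measure (witness_law d p0 v) (tail_event d p0 J \<tau>) =
      p0 * (\<Sum>g\<in>pattern_extensions d J \<tau>. v g)"
    using emeasure_witness_law_tail_event[OF p0 J v(1)] p0 v(1)
    by (auto simp: measure_def pattern_extensions_def intro!: enn2real_ennreal mult_nonneg_nonneg
        sum_nonneg)
  then show ?thesis
    using p0 copula_law_joint_df[OF prob_space_witness_law[OF p0(1) v] sets_witness_law]
    by (simp add: signed_tail_coeff_def tail_event_def in_tail_def)
qed

section \<open>Uniform margins\<close>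

abbreviation coordinate_weight ::
  "nat \<Rightarrow> (nat set \<times> (nat \<Rightarrow> side) \<Rightarrow> real) \<Rightarrow> nat \<Rightarrow> side \<Rightarrow> real" where
  "coordinate_weight d v i s \<equiv> \<Sum>g\<in>pattern_extensions d {i} (\<lambda>_. s). v g"

lemma emeasure_uniform01_tail:
  assumes "0 < p0" "p0 < 1 / 2"
  shows "emeasure uniform01 {x. in_tail p0 s x} = ennreal p0"
proof -
  have "{x. in_tail p0 s x} \<inter> {0..1} = (case s of Lower \<Rightarrow> {0..p0} | Upper \<Rightarrow> {1 - p0..1})"
    using assms by (auto simp: in_tail_def split: side.split)
  moreover have "{x. in_tail p0 s x} \<in> sets borel"
    by measurable
  ultimately show ?thesis
    using assms
    by (auto simp: emeasure_uniform01 simp del: emeasure_uniform_measure split: side.split)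
qed

text \<open>The tail event with \<open>J = {i}\<close> is an event about the margin in coordinate \<open>i\<close>, which is uniform.\<close>

lemma coordinate_weight_eq_1:
  assumes p0: "0 < p0" "p0 < 1 / 2" and i: "i \<in> {1..d}"
    and v: "\<forall>g\<in>signed_patterns d. v g \<ge> 0"
    and margin: "distr (witness_law d p0 v) borel (\<lambda>x. x i) = uniform01"
  shows "coordinate_weight d v i s = 1"
proof -
  have "tail_event d p0 {i} (\<lambda>_. s) =
      (\<lambda>x. x i) -` {x. in_tail p0 s x} \<inter> space (witness_law d p0 v)"
    by (auto simp: tail_event_def)
  moreover have "(\<lambda>x. x i) \<in> borel_measurable (witness_law d p0 v)"
    using measurable_component_singleton[OF i, of "\<lambda>_. borel"] by (simp cong: measurable_cong_sets)
  ultimately have "emeasure (witness_law d p0 v) (tail_event d p0 {i} (\<lambda>_. s)) =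
      emeasure (distr (witness_law d p0 v) borel (\<lambda>x. x i)) {x. in_tail p0 s x}"
    by (subst emeasure_distr) simp_all
  then have "ennreal (p0 * coordinate_weight d v i s) = ennreal p0"
    using emeasure_witness_law_tail_event[OF p0 _ _ v, of "{i}"] i emeasure_uniform01_tail[OF p0]
      margin by simp
  moreover have "0 \<le> coordinate_weight d v i s"
    using v by (intro sum_nonneg) (auto simp: pattern_extensions_def)
  ultimately show ?thesis
    using p0 by simp
qed

lemma emeasure_coordinate_map:
  assumes p0: "0 < p0" "p0 < 1 / 2" and A: "A \<in> sets borel"
  shows "i \<in> I \<Longrightarrow> \<sigma> i = Lower \<Longrightarrow>
      ennreal p0 * emeasure (distr uniform01 borel (coordinate_map p0 I \<sigma> i)) A =
      emeasure lborel (A \<inter> {0..p0})"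
    and "i \<in> I \<Longrightarrow> \<sigma> i = Upper \<Longrightarrow>
      ennreal p0 * emeasure (distr uniform01 borel (coordinate_map p0 I \<sigma> i)) A =
      emeasure lborel (A \<inter> {1 - p0..1})"
    and "i \<notin> I \<Longrightarrow>
      ennreal (1 - 2 * p0) * emeasure (distr uniform01 borel (coordinate_map p0 I \<sigma> i)) A =
      emeasure lborel (A \<inter> {p0..1 - p0})"
proof -
  assume "i \<in> I" "\<sigma> i = Lower"
  then have "coordinate_map p0 I \<sigma> i = (\<lambda>z. 0 + p0 * z)"
    by (simp add: coordinate_map_def fun_eq_iff)
  moreover have "(\<lambda>z. 0 + p0 * z) ` {0..1} = {0..p0}"
    using p0 by (simp add: image_mult_atLeastAtMost)
  ultimately show "ennreal p0 * emeasure (distr uniform01 borel (coordinate_map p0 I \<sigma> i)) A =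
      emeasure lborel (A \<inter> {0..p0})"
    using emeasure_affine_image_uniform01[OF _ A, of p0 0] p0 by simp
next
  assume "i \<in> I" "\<sigma> i = Upper"
  then have "coordinate_map p0 I \<sigma> i = (\<lambda>z. 1 + (- p0) * z)"
    by (simp add: coordinate_map_def fun_eq_iff)
  moreover have "(\<lambda>z. 1 + (- p0) * z) ` {0..1} = {1 - p0..1}"
    using p0 image_affinity_atLeastAtMost[of "- p0" 1 0 1] by (simp add: add.commute)
  ultimately show "ennreal p0 * emeasure (distr uniform01 borel (coordinate_map p0 I \<sigma> i)) A =
      emeasure lborel (A \<inter> {1 - p0..1})"
    using emeasure_affine_image_uniform01[OF _ A, of "- p0" 1] p0 by simp
next
  assume "i \<notin> I"
  then have "coordinate_map p0 I \<sigma> i = (\<lambda>z. p0 + (1 - 2 * p0) * z)"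
    by (simp add: coordinate_map_def fun_eq_iff)
  moreover have "(\<lambda>z. p0 + (1 - 2 * p0) * z) ` {0..1} = {p0..1 - p0}"
    using p0 image_affinity_atLeastAtMost[of "1 - 2 * p0" p0 0 1] by (simp add: add.commute)
  ultimately show "ennreal (1 - 2 * p0) *
      emeasure (distr uniform01 borel (coordinate_map p0 I \<sigma> i)) A =
      emeasure lborel (A \<inter> {p0..1 - p0})"
    using emeasure_affine_image_uniform01[OF _ A, of "1 - 2 * p0" p0] p0 by simp
qed

lemma emeasure_lborel_unit_split:
  assumes p0: "0 < p0" "p0 < 1 / 2" and A [measurable]: "A \<in> sets (borel :: real measure)"
  shows "emeasure lborel (A \<inter> {p0..1 - p0}) +
      (emeasure lborel (A \<inter> {0..p0}) + emeasure lborel (A \<inter> {1 - p0..1})) =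
    emeasure lborel (A \<inter> {0..1})"
proof -
  have "emeasure lborel (A \<inter> {0..p0}) = emeasure lborel (A \<inter> {0..<p0})"
    using AE_lborel_singleton[of p0] by (intro emeasure_eq_AE) auto
  moreover have "emeasure lborel (A \<inter> {1 - p0..1}) = emeasure lborel (A \<inter> {1 - p0<..1})"
    using AE_lborel_singleton[of "1 - p0"] by (intro emeasure_eq_AE) auto
  moreover have "emeasure lborel (A \<inter> {0..<p0}) + emeasure lborel (A \<inter> {1 - p0<..1}) =
      emeasure lborel (A \<inter> {0..<p0} \<union> A \<inter> {1 - p0<..1})"
    using p0 by (intro plus_emeasure) auto
  moreover have "emeasure lborel (A \<inter> {p0..1 - p0}) +
      emeasure lborel (A \<inter> {0..<p0} \<union> A \<inter> {1 - p0<..1}) =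
      emeasure lborel (A \<inter> {p0..1 - p0} \<union> (A \<inter> {0..<p0} \<union> A \<inter> {1 - p0<..1}))"
    using p0 by (intro plus_emeasure) auto
  moreover have "A \<inter> {p0..1 - p0} \<union> (A \<inter> {0..<p0} \<union> A \<inter> {1 - p0<..1}) = A \<inter> {0..1}"
    using p0 by auto
  ultimately show ?thesis by simp
qed

text \<open>The weights fix the mass of each tail at \<open>p0\<close>, and the total mass \<open>1\<close> then fixes that of the
  centre at \<open>1 - 2 * p0\<close>. These are the constants by which the uniform law on each piece has to be
  multiplied to become Lebesgue measure there.\<close>

lemma margin_witness_law:
  assumes p0: "0 < p0" "p0 < 1 / 2" and i: "i \<in> {1..d}"
    and v: "\<forall>g\<in>signed_patterns d. v g \<ge> 0" "central_mass d p0 v \<ge> 0"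
    and weight: "\<And>s. coordinate_weight d v i s = 1"
  shows "distr (witness_law d p0 v) borel (\<lambda>x. x i) = uniform01"
proof (rule measure_eqI)
  fix A assume "A \<in> sets (distr (witness_law d p0 v) borel (\<lambda>x. x i))"
  then have A: "A \<in> sets borel" by simp
  let ?B = "(\<lambda>x. x i) -` A \<inter> space (vec_borel d)"
  have comp: "(\<lambda>x. x i) \<in> borel_measurable (vec_borel d)"
    using measurable_component_singleton[OF i] .
  have B: "?B \<in> sets (vec_borel d)"
    by (rule measurable_sets[OF comp A])
  define piece where "piece I \<sigma> = emeasure (distr uniform01 borel (coordinate_map p0 I \<sigma> i)) A"
    for I \<sigma>
  define centre where "centre = piece {} (\<lambda>_. Lower)"
  have piece: "emeasure (distr M borel (\<lambda>x. x i)) A = emeasure M ?B"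
    if "sets M = sets (vec_borel d)" for M
    using comp A that sets_eq_imp_space_eq[OF that]
    by (subst emeasure_distr) (simp_all cong: measurable_cong_sets)
  have central: "emeasure (central_law d p0) ?B = centre"
    using piece[of "central_law d p0"] margin_central_law[OF i]
    by (simp add: centre_def piece_def)
  have pattern: "emeasure (pattern_law d p0 (I, \<sigma>)) ?B = piece I \<sigma>" for I \<sigma>
    using piece[of "pattern_law d p0 (I, \<sigma>)"] margin_pattern_law[OF i]
    by (simp add: piece_def)
  \<comment> \<open>The margin of a pattern in coordinate \<open>i\<close> only depends on whether it lies in the lower tail, the
    upper tail or the centre there, so only the total weights of these three groups matter; those
    in the centre have the same margin as the central law and are merged with it.\<close>
  let ?E = "\<lambda>s. pattern_extensions d {i} (\<lambda>_. s)"
  define R where "R = {(I, \<sigma>) \<in> signed_patterns d. i \<notin> I}"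
  have split: "(\<Sum>g\<in>signed_patterns d. f g) = (\<Sum>g\<in>R. f g) + ((\<Sum>g\<in>?E Lower. f g) + (\<Sum>g\<in>?E Upper. f g))"
    for f :: "nat set \<times> (nat \<Rightarrow> side) \<Rightarrow> 'b :: comm_monoid_add"
  proof -
    have fin: "finite R" "finite (?E s)" for s
      by (auto simp: R_def pattern_extensions_def intro: finite_subset[OF _ finite_signed_patterns])
    have "signed_patterns d = R \<union> (?E Lower \<union> ?E Upper)"
      by (auto simp: R_def pattern_extensions_def intro: side.exhaust)
    moreover have "?E Lower \<inter> ?E Upper = {}" "R \<inter> (?E Lower \<union> ?E Upper) = {}"
      by (auto simp: R_def pattern_extensions_def)
    ultimately show ?thesis
      using fin by (simp add: sum.union_disjoint)
  qed
  have v': "v g \<ge> 0" if "g \<in> R \<or> g \<in> ?E s" for g s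
    using that v(1) by (auto simp: R_def pattern_extensions_def)
  have tail: "(\<Sum>g\<in>?E s. ennreal (p0 * v g) * emeasure (pattern_law d p0 g) ?B) =
      emeasure lborel (A \<inter> (case s of Lower \<Rightarrow> {0..p0} | Upper \<Rightarrow> {1 - p0..1}))" for s
  proof -
    have "ennreal (p0 * v g) * emeasure (pattern_law d p0 g) ?B =
        ennreal (v g) * emeasure lborel (A \<inter> (case s of Lower \<Rightarrow> {0..p0} | Upper \<Rightarrow> {1 - p0..1}))"
      if g: "g \<in> ?E s" for g
    proof -
      obtain I \<sigma> where I: "g = (I, \<sigma>)" by (cases g)
      with g have "i \<in> I" "\<sigma> i = s"
        by (auto simp: pattern_extensions_def)
      then have "ennreal p0 * piece I \<sigma> =
          emeasure lborel (A \<inter> (case s of Lower \<Rightarrow> {0..p0} | Upper \<Rightarrow> {1 - p0..1}))"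
        using emeasure_coordinate_map[OF p0 A] by (auto simp: piece_def split: side.split)
      moreover have "ennreal (p0 * v g) * piece I \<sigma> = ennreal (v g) * (ennreal p0 * piece I \<sigma>)"
        using p0 by (simp add: ennreal_mult' ac_simps)
      ultimately show ?thesis
        by (simp only: I pattern)
    qed
    then show ?thesis
      using weight[of s] v'[of _ s] by (simp add: sum_ennreal flip: sum_distrib_right)
  qed
  have rest: "(\<Sum>g\<in>R. ennreal (p0 * v g) * emeasure (pattern_law d p0 g) ?B) =
      ennreal (p0 * (\<Sum>g\<in>R. v g)) * centre"
  proof -
    have "emeasure (pattern_law d p0 g) ?B = centre" if "g \<in> R" for g
    proof -
      obtain I \<sigma> where I: "g = (I, \<sigma>)" by (cases g)
      with that have "coordinate_map p0 I \<sigma> i = coordinate_map p0 {} (\<lambda>_. Lower) i"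
        by (simp add: R_def coordinate_map_def fun_eq_iff)
      then show ?thesis
        by (simp only: I pattern centre_def piece_def)
    qed
    then have "(\<Sum>g\<in>R. ennreal (p0 * v g) * emeasure (pattern_law d p0 g) ?B) =
        (\<Sum>g\<in>R. ennreal (p0 * v g)) * centre"
      by (simp add: sum_distrib_right)
    then show ?thesis
      using p0 v' by (simp add: sum_ennreal sum_distrib_left)
  qed
  have mass: "central_mass d p0 v + p0 * (\<Sum>g\<in>R. v g) = 1 - 2 * p0"
    using split[of v] weight by (simp add: central_mass_def algebra_simps)
  have "emeasure (distr (witness_law d p0 v) borel (\<lambda>x. x i)) A =
      ennreal (central_mass d p0 v) * centre + ennreal (p0 * (\<Sum>g\<in>R. v g)) * centre +
      (emeasure lborel (A \<inter> {0..p0}) + emeasure lborel (A \<inter> {1 - p0..1}))"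
    using piece[of "witness_law d p0 v"] B
    by (simp add: emeasure_witness_law central split tail rest add.assoc del: One_nat_def)
  also have "ennreal (central_mass d p0 v) * centre + ennreal (p0 * (\<Sum>g\<in>R. v g)) * centre =
      ennreal (1 - 2 * p0) * centre"
    using p0 v(2) v' mass
    by (simp add: sum_nonneg flip: distrib_right ennreal_plus)
  also have "ennreal (1 - 2 * p0) * centre = emeasure lborel (A \<inter> {p0..1 - p0})"
    using emeasure_coordinate_map(3)[OF p0 A] by (simp add: centre_def piece_def)
  also have "\<dots> + (emeasure lborel (A \<inter> {0..p0}) + emeasure lborel (A \<inter> {1 - p0..1})) =
      emeasure uniform01 A"
    by (simp only: emeasure_lborel_unit_split[OF p0 A] emeasure_uniform01[OF A])
  finally show "emeasure (distr (witness_law d p0 v) borel (\<lambda>x. x i)) A = emeasure uniform01 A" .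
qed simp

lemma uniform_margins_witness_law_iff:
  assumes "0 < p0" "p0 < 1 / 2"
    and "\<forall>g\<in>signed_patterns d. v g \<ge> 0" "central_mass d p0 v \<ge> 0"
  shows "uniform_margins d (witness_law d p0 v) \<longleftrightarrow>
    (\<forall>i\<in>{1..d}. coordinate_weight d v i Lower = 1 \<and> coordinate_weight d v i Upper = 1)"
proof
  assume "uniform_margins d (witness_law d p0 v)"
  then show "\<forall>i\<in>{1..d}. coordinate_weight d v i Lower = 1 \<and> coordinate_weight d v i Upper = 1"
    using coordinate_weight_eq_1[OF assms(1,2) _ assms(3)] by (simp add: uniform_margins_def)
next
  assume *: "\<forall>i\<in>{1..d}. coordinate_weight d v i Lower = 1 \<and> coordinate_weight d v i Upper = 1"
  have "coordinate_weight d v i s = 1" if "i \<in> {1..d}" for i s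
    using * that by (cases s) auto
  then show "uniform_margins d (witness_law d p0 v)"
    using margin_witness_law[OF assms(1,2) _ assms(3,4)] by (simp add: uniform_margins_def)
qed

section \<open>Realizability as a linear system\<close>

text \<open>Agreement on \<open>J\<close> can be written as \<open>restrict \<sigma> J = \<tau>\<close> because \<open>\<tau>\<close> is extensional, and the
  sets \<open>I \<supseteq> J\<close> are automatically nonempty because \<open>J\<close> is.\<close>

lemma sum_pattern_extensions:
  assumes "(J, \<tau>) \<in> signed_patterns d"
  shows "(\<Sum>g\<in>pattern_extensions d J \<tau>. w g) =
    (\<Sum>I | J \<subseteq> I \<and> I \<subseteq> {1..d}. \<Sum>\<sigma> | \<sigma> \<in> I \<rightarrow>\<^sub>E UNIV \<and> restrict \<sigma> J = \<tau>. w (I, \<sigma>))"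
proof -
  have J: "J \<noteq> {}" "\<tau> \<in> extensional J"
    using assms by (auto simp: signed_patterns_def PiE_def)
  have agree: "restrict \<sigma> J = \<tau> \<longleftrightarrow> (\<forall>i\<in>J. \<sigma> i = \<tau> i)" for \<sigma>
    using J(2) by (auto simp: fun_eq_iff extensional_def restrict_def)
  have "pattern_extensions d J \<tau> =
      (SIGMA I : {I. J \<subseteq> I \<and> I \<subseteq> {1..d}}. {\<sigma>. \<sigma> \<in> I \<rightarrow>\<^sub>E UNIV \<and> restrict \<sigma> J = \<tau>})"
    using J(1) by (auto simp: pattern_extensions_def signed_patterns_def agree)
  moreover have "finite {I. J \<subseteq> I \<and> I \<subseteq> {1..d}}"
    by (rule finite_subset[of _ "Pow {1..d}"]) auto
  moreover have "finite {\<sigma>. \<sigma> \<in> I \<rightarrow>\<^sub>E (UNIV :: side set) \<and> restrict \<sigma> J = \<tau>}"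
    if "I \<subseteq> {1..d}" for I
    using finite_PiE[of I "\<lambda>_. UNIV :: side set"] finite_UNIV_side that
    by (auto intro: finite_subset)
  ultimately show ?thesis
    by (subst sum.Sigma) auto
qed

lemma coordinate_weight_eq_sum:
  "coordinate_weight d w i s =
    (\<Sum>(I, \<sigma>) | (I, \<sigma>) \<in> signed_patterns d \<and> i \<in> I \<and> \<sigma> i = s. w (I, \<sigma>))"
  by (rule sum.cong) (auto simp: pattern_extensions_def)

lemma central_mass_nonneg_iff:
  assumes "0 < p0"
  shows "central_mass d p0 w \<ge> 0 \<longleftrightarrow> (\<Sum>g\<in>signed_patterns d. w g) \<le> 1 / p0"
  using assms by (simp add: central_mass_def field_simps)

theorem proposition9:
  fixes d :: nat and p0 :: real
    and S :: "(nat set \<times> (nat \<Rightarrow> side)) set"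
    and target :: "nat set \<times> (nat \<Rightarrow> side) \<Rightarrow> real"
  assumes "d \<ge> 1" and "0 < p0" and "p0 < 1 / 2" and "S \<subseteq> signed_patterns d"
  shows "witness_realizable d p0 S target \<longleftrightarrow>
    (\<exists>w :: nat set \<times> (nat \<Rightarrow> side) \<Rightarrow> real.
       (\<forall>(I, \<sigma>)\<in>signed_patterns d. w (I, \<sigma>) \<ge> 0) \<and>
       (\<forall>(J, \<tau>)\<in>S.
          (\<Sum>I | J \<subseteq> I \<and> I \<subseteq> {1..d}.
             \<Sum>\<sigma> | \<sigma> \<in> I \<rightarrow>\<^sub>E UNIV \<and> restrict \<sigma> J = \<tau>. w (I, \<sigma>)) = target (J, \<tau>)) \<and>
       (\<forall>i\<in>{1..d}.
          (\<Sum>(I, \<sigma>) | (I, \<sigma>) \<in> signed_patterns d \<and> i \<in> I \<and> \<sigma> i = Lower. w (I, \<sigma>)) = 1 \<and>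
          (\<Sum>(I, \<sigma>) | (I, \<sigma>) \<in> signed_patterns d \<and> i \<in> I \<and> \<sigma> i = Upper. w (I, \<sigma>)) = 1) \<and>
       (\<Sum>(I, \<sigma>)\<in>signed_patterns d. w (I, \<sigma>)) \<le> 1 / p0)"
proof -
  let ?targets = "\<lambda>w. \<forall>(J, \<tau>)\<in>S.
    (\<Sum>I | J \<subseteq> I \<and> I \<subseteq> {1..d}.
       \<Sum>\<sigma> | \<sigma> \<in> I \<rightarrow>\<^sub>E UNIV \<and> restrict \<sigma> J = \<tau>. w (I, \<sigma>)) = target (J, \<tau>)"
  have targets: "(\<forall>g\<in>S. signed_tail_coeff d p0 (joint_df d (witness_law d p0 w)) g = target g)
      \<longleftrightarrow> ?targets w"
    if "\<forall>g\<in>signed_patterns d. w g \<ge> 0" "central_mass d p0 w \<ge> 0" for w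
  proof -
    have "signed_tail_coeff d p0 (joint_df d (witness_law d p0 w)) (J, \<tau>) =
        (\<Sum>I | J \<subseteq> I \<and> I \<subseteq> {1..d}.
          \<Sum>\<sigma> | \<sigma> \<in> I \<rightarrow>\<^sub>E UNIV \<and> restrict \<sigma> J = \<tau>. w (I, \<sigma>))" if "(J, \<tau>) \<in> S" for J \<tau>
    proof -
      have *: "(J, \<tau>) \<in> signed_patterns d"
        using that assms(4) by blast
      then have "J \<noteq> {}" "J \<subseteq> {1..d}"
        by (auto simp: signed_patterns_def)
      then show ?thesis
        using signed_tail_coeff_witness[OF assms(2,3) _ _ \<open>\<forall>g\<in>signed_patterns d. w g \<ge> 0\<close>
            \<open>central_mass d p0 w \<ge> 0\<close>] sum_pattern_extensions[OF *]
        by simp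
    qed
    then show ?thesis
      by (intro ball_cong) auto
  qed
  have "witness_realizable d p0 S target \<longleftrightarrow>
    (\<exists>w. (\<forall>g\<in>signed_patterns d. w g \<ge> 0) \<and> central_mass d p0 w \<ge> 0 \<and>
       uniform_margins d (witness_law d p0 w) \<and>
       (\<forall>g\<in>S. signed_tail_coeff d p0 (joint_df d (witness_law d p0 w)) g = target g))"
    unfolding witness_realizable_def geometric_witness_copula_def by blast
  also have "\<dots> \<longleftrightarrow>
    (\<exists>w. (\<forall>g\<in>signed_patterns d. w g \<ge> 0) \<and> ?targets w \<and>
       (\<forall>i\<in>{1..d}. coordinate_weight d w i Lower = 1 \<and> coordinate_weight d w i Upper = 1) \<and>
       central_mass d p0 w \<ge> 0)"
    using uniform_margins_witness_law_iff[OF assms(2,3)] targets by (intro ex_cong1) blast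
  finally show ?thesis
    unfolding coordinate_weight_eq_sum central_mass_nonneg_iff[OF assms(2)]
    by (simp add: case_prod_beta')
qed

end
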